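(* Consider, for an ensemble of $J$ particles in $\mathbb R^d$, the linear second-order EKI system $$\ddot x_j+\gamma\dot x_j=-\beta C(X)(Ax_j-b)+k\sum_{i\neq j}f(\|x_i-x_j\|)(x_j-x_i)-\alpha(x_j-\bar x),\qquad j=1,\dots,J.$$ Assume that $f$ is continuous at the origin and let $f(0)>0$. Consider a fully collapsed configuration $$x_1=\cdots=x_J=x_*,\qquad \dot x_1=\cdots=\dot x_J=0.$$ Then this configuration is linearly unstable with respect to zero-mean fluctuation perturbations under the supercritical condition $$kJf(0)>\alpha.$$ In particular, for the kernel $f(r)=(\varepsilon+r)^{-p}$ with $\varepsilon>0$, $p>1$, this condition becomes $k>\alpha\varepsilon^p/J$.
   Context: Here $x_j(t)\in\mathbb R^d$, $x_*\in\mathbb R^d$, $X=\{x_j\}_{j=1}^J$, $\bar x=\frac1J\sum_jx_j$, $C(X)=\frac1J\sum_{j=1}^J(x_j-\bar x)(x_j-\bar x)^T$; $G\in\mathbb R^{K\times d}$ is a matrix, $\Gamma\in\mathbb R^{K\times K}$ is symmetric positive definite, $y\in\mathbb R^K$, $A:=G^T\Gamma^{-1}G$, $b:=G^T\Gamma^{-1}y$. Parameters: $\gamma>0$, $\beta>0$, $k\ge0$, $\alpha\ge0$. The interaction kernel is a smooth non-increasing function $f:[0,\infty)\to(0,\infty)$. $\|\cdot\|$ is the Euclidean norm. Zero-mean fluctuation perturbations: perturbations $x_j=x_*+\delta x_j$, $\dot x_j=\delta\dot x_j$ with $\sum_j\delta x_j=0$ and $\sum_j\delta\dot x_j=0$.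 The fluctuations $\tilde x_j=x_j-\bar x$ satisfy a closed autonomous system on the zero-mean space, $$\ddot{\tilde x}_j+\gamma\dot{\tilde x}_j=-\beta C(X)A\tilde x_j-\alpha\tilde x_j+k\sum_{i\ne j}f(\|\tilde x_i-\tilde x_j\|)(\tilde x_j-\tilde x_i),$$ where $C(X)=\frac1J\sum_j\tilde x_j\tilde x_j^T$. "Linearly unstable with respect to zero-mean fluctuation perturbations" means that the linearization of this system (written in first-order form in $(\tilde x,\dot{\tilde x})$) at the collapsed state $\tilde x=0$, $\dot{\tilde x}=0$, restricted to the zero-mean space $\{(\delta x,\delta\dot x):\sum_j\delta x_j=0,\ \sum_j\delta\dot x_j=0\}$, has an eigenvalue with strictly positive real part. *)

theory Defs
  imports "HOL-Analysis.Analysis"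
begin

text \<open>
  An ensemble of \<open>J\<close> particles in d-dimensional Euclidean space is a vector of vectors, of type
  \<open>real ^ 'd ^ 'j\<close> with \<open>J = CARD('j)\<close>; the position of particle \<open>j\<close> is \<open>X $ j\<close>.
  Second-order systems are written in first-order form, so a state is a pair
  (positions, velocities).
\<close>

type_synonym ('d, 'j) state = "(real ^ 'd ^ 'j) \<times> (real ^ 'd ^ 'j)"

definition ens_mean :: "real ^ 'd ^ 'j \<Rightarrow> real ^ 'd" where
  "ens_mean X = (1 / real CARD('j)) *\<^sub>R (\<Sum>j\<in>UNIV. X $ j)"

definition ens_fluct :: "real ^ 'd ^ 'j \<Rightarrow> real ^ 'd ^ 'j" where
  "ens_fluct X = (\<chi> j. X $ j - ens_mean X)"

definition fluctuation :: "('d::finite, 'j::finite) state \<Rightarrow> ('d, 'j) state" where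
  "fluctuation s = (ens_fluct (fst s), ens_fluct (snd s))"

definition zero_mean_states :: "('d::finite, 'j::finite) state set" where
  "zero_mean_states = {s. (\<Sum>j\<in>UNIV. fst s $ j) = 0 \<and> (\<Sum>j\<in>UNIV. snd s $ j) = 0}"

definition self_outer :: "real ^ 'd \<Rightarrow> real ^ 'd ^ 'd" where
  "self_outer u = (\<chi> a b. u $ a * u $ b)"

definition ens_cov :: "real ^ 'd ^ 'j \<Rightarrow> real ^ 'd ^ 'd" where
  "ens_cov X = (1 / real CARD('j)) *\<^sub>R (\<Sum>j\<in>UNIV. self_outer (X $ j - ens_mean X))"

definition sym_pos_def :: "real ^ 'n ^ 'n \<Rightarrow> bool" where
  "sym_pos_def M \<longleftrightarrow> transpose M = M \<and> (\<forall>v. v \<noteq> 0 \<longrightarrow> 0 < v \<bullet> (M *v v))"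

definition eki_A :: "real ^ 'd ^ 'm \<Rightarrow> real ^ 'm ^ 'm \<Rightarrow> real ^ 'd ^ 'd" where
  "eki_A G \<Gamma> = transpose G ** matrix_inv \<Gamma> ** G"

definition eki_b :: "real ^ 'd ^ 'm \<Rightarrow> real ^ 'm ^ 'm \<Rightarrow> real ^ 'm \<Rightarrow> real ^ 'd" where
  "eki_b G \<Gamma> y = (transpose G ** matrix_inv \<Gamma>) *v y"

text \<open>
  A kernel is a function on the half line; it is represented by a function on the reals of which
  only the values on \<open>{0..}\<close> matter. Smoothness is up to and including the end point 0, with
  one-sided derivatives there: \<open>F n\<close> is the n-th derivative.
\<close>

definition smooth_on_half_line :: "(real \<Rightarrow> real) \<Rightarrow> bool" where
  "smooth_on_half_line f \<longleftrightarrow>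
     (\<exists>F :: nat \<Rightarrow> real \<Rightarrow> real. F 0 = f \<and>
        (\<forall>n. \<forall>r\<ge>0. (F n has_real_derivative F (Suc n) r) (at r within {0..})))"

definition interaction_kernel :: "(real \<Rightarrow> real) \<Rightarrow> bool" where
  "interaction_kernel f \<longleftrightarrow>
     smooth_on_half_line f \<and> antimono_on {0..} f \<and> (\<forall>r\<ge>0. 0 < f r)"

definition power_kernel :: "real \<Rightarrow> real \<Rightarrow> real \<Rightarrow> real" where
  "power_kernel \<epsilon> p r = (\<epsilon> + r) powr (- p)"

definition repulsion :: "(real \<Rightarrow> real) \<Rightarrow> real ^ 'd ^ 'j \<Rightarrow> 'j \<Rightarrow> real ^ 'd" where
  "repulsion f X j = (\<Sum>i\<in>UNIV - {j}. f (norm (X $ i - X $ j)) *\<^sub>R (X $ j - X $ i))"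

definition eki_field ::
  "real \<Rightarrow> real \<Rightarrow> real \<Rightarrow> real \<Rightarrow> (real \<Rightarrow> real) \<Rightarrow> real ^ 'd ^ 'd \<Rightarrow> real ^ 'd
     \<Rightarrow> ('d::finite, 'j::finite) state \<Rightarrow> ('d, 'j) state" where
  "eki_field \<gamma> \<beta> k \<alpha> f A b = (\<lambda>(X, V).
     (V, \<chi> j. - \<gamma> *\<^sub>R (V $ j) - \<beta> *\<^sub>R (ens_cov X *v (A *v (X $ j) - b))
              + k *\<^sub>R repulsion f X j - \<alpha> *\<^sub>R (X $ j - ens_mean X)))"

text \<open>
  The closed system satisfied by the fluctuations. It is of interest on
  \<open>zero_mean_states\<close>; the formula also makes sense elsewhere.
\<close>

definition fluct_field ::
  "real \<Rightarrow> real \<Rightarrow> real \<Rightarrow> real \<Rightarrow> (real \<Rightarrow> real) \<Rightarrow> real ^ 'd ^ 'd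
     \<Rightarrow> ('d::finite, 'j::finite) state \<Rightarrow> ('d, 'j) state" where
  "fluct_field \<gamma> \<beta> k \<alpha> f A = (\<lambda>(X, V).
     (V, \<chi> j. - \<gamma> *\<^sub>R (V $ j)
              - \<beta> *\<^sub>R (((1 / real CARD('j)) *\<^sub>R (\<Sum>i\<in>UNIV. self_outer (X $ i))) *v (A *v (X $ j)))
              - \<alpha> *\<^sub>R (X $ j) + k *\<^sub>R repulsion f X j))"

text \<open>
  \<open>z\<close> is an eigenvalue of (the complexification of) the real-linear map \<open>L\<close> on the complexified
  subspace \<open>S\<close>: the equations are the real and imaginary parts of \<open>L (u + i w) = z (u + i w)\<close>.
\<close>

definition complex_eigenvalue_on ::
  "'a :: real_vector set \<Rightarrow> ('a \<Rightarrow> 'a) \<Rightarrow> complex \<Rightarrow> bool" where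
  "complex_eigenvalue_on S L z \<longleftrightarrow>
     (\<exists>u\<in>S. \<exists>w\<in>S. (u, w) \<noteq> (0, 0) \<and>
        L u = Re z *\<^sub>R u - Im z *\<^sub>R w \<and>
        L w = Im z *\<^sub>R u + Re z *\<^sub>R w)"

definition unstable_linearization_on ::
  "'a :: real_normed_vector set \<Rightarrow> ('a \<Rightarrow> 'a) \<Rightarrow> 'a \<Rightarrow> bool" where
  "unstable_linearization_on S \<Phi> s \<longleftrightarrow>
     (\<exists>L. (\<Phi> has_derivative L) (at s within S) \<and> (\<exists>z. complex_eigenvalue_on S L z \<and> 0 < Re z))"

text \<open>
  Linear instability of the state \<open>s\<close> of \<open>s' = F s\<close> with respect to zero-mean fluctuation
  perturbations. The first conjunct says that \<open>\<Phi>\<close> is the closed autonomous system governing the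
  fluctuations; it determines \<open>\<Phi>\<close> on \<open>zero_mean_states\<close>.
\<close>

definition zero_mean_linearly_unstable ::
  "(('d::finite, 'j::finite) state \<Rightarrow> ('d, 'j) state) \<Rightarrow> (('d, 'j) state \<Rightarrow> ('d, 'j) state)
     \<Rightarrow> ('d::finite, 'j::finite) state \<Rightarrow> bool" where
  "zero_mean_linearly_unstable F \<Phi> s \<longleftrightarrow>
     (\<forall>t. fluctuation (F t) = \<Phi> (fluctuation t)) \<and>
     unstable_linearization_on zero_mean_states \<Phi> (fluctuation s)"

definition collapsed_state :: "real ^ 'd \<Rightarrow> ('d::finite, 'j::finite) state" where
  "collapsed_state x = ((\<chi> j. x), 0)"

lemma sum_repulsion_eq_0: "(\<Sum>j\<in>UNIV. repulsion f X j) = 0"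
proof -
  let ?g = "\<lambda>i j. f (norm (X $ i - X $ j)) *\<^sub>R (X $ j - X $ i)"
  have *: "repulsion f X j = (\<Sum>i\<in>UNIV. ?g i j)" for j
    unfolding repulsion_def by (rule sum.mono_neutral_left) auto
  let ?S = "\<Sum>j\<in>UNIV. \<Sum>i\<in>UNIV. ?g i j"
  have "?S = (\<Sum>i\<in>UNIV. \<Sum>j\<in>UNIV. ?g i j)" by (rule sum.swap)
  also have "\<dots> = (\<Sum>i\<in>UNIV. \<Sum>j\<in>UNIV. - ?g j i)"
    by (intro sum.cong refl) (subst norm_minus_commute, simp flip: scaleR_minus_right)
  also have "\<dots> = - ?S" by (simp add: sum_negf)
  finally have "?S + ?S = 0" by (simp only: eq_neg_iff_add_eq_0)
  then have "2 *\<^sub>R ?S = 0" by (simp only: scaleR_2)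
  then have "?S = 0" by (simp only: scaleR_eq_0_iff) simp
  then show ?thesis by (simp only: *)
qed

lemma fluctuation_collapsed_state: "fluctuation (collapsed_state x) = 0"
  by (simp add: fluctuation_def collapsed_state_def ens_fluct_def ens_mean_def vec_eq_iff
      zero_prod_def sum_constant_scaleR del: sum_constant)

lemma eki_field_collapsed_state: "eki_field \<gamma> \<beta> k \<alpha> f A b (collapsed_state x) = 0"
  by (simp add: eki_field_def collapsed_state_def ens_mean_def ens_cov_def repulsion_def
      self_outer_def vec_eq_iff zero_prod_def sum_constant_scaleR matrix_vector_mult_def del: sum_constant)

lemma fluctuation_eki_field:
  fixes s :: "('d::finite, 'j::finite) state"
  shows "fluctuation (eki_field \<gamma> \<beta> k \<alpha> f A b s) = fluct_field \<gamma> \<beta> k \<alpha> f A (fluctuation s)"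
proof -
  obtain X V where s: "s = (X, V)" by (cases s)
  let ?J = "real CARD('j)"
  let ?m = "ens_mean X" and ?n = "ens_mean V"
  have sX: "(\<Sum>j\<in>UNIV. X $ j) = ?J *\<^sub>R ?m" and sV: "(\<Sum>j\<in>UNIV. V $ j) = ?J *\<^sub>R ?n"
    by (simp_all add: ens_mean_def)
  have lin: "(\<Sum>j\<in>UNIV. M *v (f j)) = M *v (\<Sum>j\<in>UNIV. f j)"
    for M :: "real ^ 'd ^ 'd" and f :: "'j \<Rightarrow> real ^ 'd"
    by (simp add: linear_sum)
  let ?a = "\<chi> j. - \<gamma> *\<^sub>R (V $ j) - \<beta> *\<^sub>R (ens_cov X *v (A *v (X $ j) - b))
              + k *\<^sub>R repulsion f X j - \<alpha> *\<^sub>R (X $ j - ?m)"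
  have "(\<Sum>j\<in>UNIV. ?a $ j) = - \<gamma> *\<^sub>R (?J *\<^sub>R ?n)
          - \<beta> *\<^sub>R (ens_cov X *v (A *v (?J *\<^sub>R ?m) - ?J *\<^sub>R b))"
    by (simp add: sum.distrib sum_subtractf sum_negf lin sX sV sum_repulsion_eq_0
        sum_constant_scaleR del: sum_constant flip: scaleR_sum_right)
  also have "\<dots> = ?J *\<^sub>R (- \<gamma> *\<^sub>R ?n - \<beta> *\<^sub>R (ens_cov X *v (A *v ?m - b)))"
    by (simp add: matrix_vector_mult_scaleR matrix_vector_mult_diff_distrib algebra_simps)
  finally have mean_a: "ens_mean ?a = - \<gamma> *\<^sub>R ?n - \<beta> *\<^sub>R (ens_cov X *v (A *v ?m - b))"
    unfolding ens_mean_def[of ?a] by simp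
  have rep: "repulsion f (ens_fluct X) j = repulsion f X j" for j
    by (simp add: repulsion_def ens_fluct_def)
  have cov: "(1 / ?J) *\<^sub>R (\<Sum>i\<in>UNIV. self_outer (ens_fluct X $ i)) = ens_cov X"
    by (simp add: ens_cov_def ens_fluct_def)
  have "ens_fluct ?a = snd (fluct_field \<gamma> \<beta> k \<alpha> f A (fluctuation s))"
    unfolding s fluct_field_def fluctuation_def fst_conv snd_conv case_prod_conv cov rep
    unfolding ens_fluct_def[of ?a] mean_a
    by (simp add: vec_eq_iff ens_fluct_def matrix_vector_mult_diff_distrib algebra_simps)
  then show ?thesis
    by (simp add: s fluctuation_def eki_field_def fluct_field_def)
qed

end

theory Submission
  imports Defs
begin

text \<open>
  Both nonlinear terms of the fluctuation field are products of a scalar that tends to 0 and a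
  linear map, so they do not contribute to the linearization at the collapsed state. On the
  zero-mean space each particle therefore follows \<open>x'' + \<gamma> x' = c x\<close> with
  \<open>c = k J f(0) - \<alpha>\<close>. For \<open>c > 0\<close> the characteristic polynomial \<open>\<lambda>\<^sup>2 + \<gamma> \<lambda> - c\<close> has a
  positive root, and two particles displaced in opposite directions give an eigenvector.
\<close>

section \<open>Differentiation rules for vectors and infinitesimal factors\<close>

lemma has_derivative_vec_lambda:
  fixes g :: "'a::real_normed_vector \<Rightarrow> 'n::finite \<Rightarrow> 'b::euclidean_space"
  assumes "\<And>i. ((\<lambda>x. g x i) has_derivative (\<lambda>h. g' h i)) (at a within S)"
  shows "((\<lambda>x. \<chi> i. g x i) has_derivative (\<lambda>h. \<chi> i. g' h i)) (at a within S)"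
  unfolding has_derivative_componentwise_within[of "\<lambda>x. \<chi> i. g x i"]
  by (auto simp: Basis_vec_def inner_axis intro!: has_derivative_inner_left assms)

text \<open>With \<open>norm (l x) \<le> norm x * K\<close>, the product is at most
  \<open>\<bar>h x\<bar> * K * norm x\<close>, which is o(norm x). Only a limit of \<open>h\<close>
  enters, so \<open>h\<close> may contain the norm, which is not differentiable at 0.\<close>

lemma has_derivative_scaleR_infinitesimal:
  fixes l :: "'a::real_normed_vector \<Rightarrow> 'b::real_normed_vector"
  assumes h: "(h \<longlongrightarrow> 0) (at 0 within S)" and l: "bounded_linear l"
  shows "((\<lambda>x. h x *\<^sub>R l x) has_derivative (\<lambda>_. 0)) (at 0 within S)"
proof -
  obtain K where K: "\<And>x. norm (l x) \<le> norm x * K" "K \<ge> 0"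
    using bounded_linear.nonneg_bounded[OF l] by blast
  have l0: "l 0 = 0" using l by (simp add: linear_simps)
  show ?thesis
  proof (rule has_derivativeI_sandwich[where e = 1 and H = "\<lambda>x. \<bar>h x\<bar> * K"])
    fix y assume "y \<in> S" "y \<noteq> 0" "dist y 0 < 1"
    have "\<bar>h y\<bar> * norm (l y) \<le> \<bar>h y\<bar> * (norm y * K)"
      by (intro mult_left_mono K) simp
    with \<open>y \<noteq> 0\<close> show "norm (h y *\<^sub>R l y - h 0 *\<^sub>R l 0 - 0) / norm (y - 0) \<le> \<bar>h y\<bar> * K"
      by (simp add: l0 divide_le_eq mult_ac)
  next
    show "((\<lambda>x. \<bar>h x\<bar> * K) \<longlongrightarrow> 0) (at 0 within S)"
      using tendsto_mult_left_zero[OF tendsto_rabs_zero[OF h]] .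
  qed simp_all
qed

section \<open>The fluctuation field on the zero-mean space and its linearization\<close>

lemma self_outer_mult_vector: "self_outer u *v v = (u \<bullet> v) *\<^sub>R u"
  by (simp add: vec_eq_iff self_outer_def matrix_vector_mult_def inner_vec_def
      sum_distrib_left sum_distrib_right mult_ac)

lemma sum_matrix_vector_mult: "(\<Sum>i\<in>I. M i) *v v = (\<Sum>i\<in>I. M i *v v)"
  for M :: "'i \<Rightarrow> real ^ 'n ^ 'm"
  by (induction I rule: infinite_finite_induct) (simp_all add: matrix_vector_mult_add_rdistrib)

text \<open>Split each kernel value into \<open>c\<close> and its deviation from \<open>c\<close>.
  The constant part is linear in \<open>X\<close>, and the sum of the \<open>X $ i\<close> drops out
  by zero mean. The choice \<open>c = f 0\<close> makes the deviations vanish at collapse.\<close>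

lemma repulsion_zero_mean:
  fixes X :: "real ^ 'd ^ 'j::finite"
  assumes "(\<Sum>j\<in>UNIV. X $ j) = 0"
  shows "repulsion f X j = (real CARD('j) * c) *\<^sub>R (X $ j)
    + (\<Sum>i\<in>UNIV - {j}. (f (norm (X $ i - X $ j)) - c) *\<^sub>R (X $ j - X $ i))"
proof -
  have "(\<Sum>i\<in>UNIV - {j}. X $ j - X $ i) = (\<Sum>i\<in>UNIV. X $ j - X $ i)"
    by (rule sum.mono_neutral_left) auto
  also have "\<dots> = real CARD('j) *\<^sub>R (X $ j)"
    using assms by (simp add: sum_subtractf sum_constant_scaleR del: sum_constant)
  finally have "(real CARD('j) * c) *\<^sub>R (X $ j) = c *\<^sub>R (\<Sum>i\<in>UNIV - {j}. X $ j - X $ i)"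
    by (simp add: mult.commute)
  then show ?thesis
    by (simp add: repulsion_def scaleR_sum_right flip: sum.distrib scaleR_add_left)
qed

text \<open>Derivative along zero-mean states only: in other directions the interaction would add
  \<open>- k * f 0\<close> times the sum of the positions.\<close>

definition collapsed_linearization ::
  "real \<Rightarrow> real \<Rightarrow> ('d::finite, 'j::finite) state \<Rightarrow> ('d, 'j) state" where
  "collapsed_linearization \<gamma> c = (\<lambda>s. (snd s, \<chi> j. - \<gamma> *\<^sub>R (snd s $ j) + c *\<^sub>R (fst s $ j)))"

text \<open>Isolates the linear part. The rank-one matrices \<open>self_outer\<close> turn the
  covariance term into inner products times positions, so both remainders become sums of an
  infinitesimal scalar times a linear map.\<close>

lemma fluct_field_zero_mean:
  fixes s :: "('d::finite, 'j::finite) state"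
  assumes "s \<in> zero_mean_states"
  shows "fluct_field \<gamma> \<beta> k \<alpha> f A s = (snd s, \<chi> j.
    (- \<gamma> *\<^sub>R (snd s $ j) + (k * real CARD('j) * f 0 - \<alpha>) *\<^sub>R (fst s $ j))
    - (\<beta> / real CARD('j)) *\<^sub>R (\<Sum>i\<in>UNIV. (fst s $ i \<bullet> (A *v (fst s $ j))) *\<^sub>R (fst s $ i))
    + k *\<^sub>R (\<Sum>i\<in>UNIV - {j}.
        (f (norm (fst s $ i - fst s $ j)) - f 0) *\<^sub>R (fst s $ j - fst s $ i)))"
proof -
  obtain X V where s: "s = (X, V)" by (cases s)
  have X: "(\<Sum>j\<in>UNIV. X $ j) = 0"
    using assms by (simp add: zero_mean_states_def s)
  show ?thesis
    by (simp add: s fluct_field_def repulsion_zero_mean[OF X, of f _ "f 0"] self_outer_mult_vector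
        sum_matrix_vector_mult vec_eq_iff algebra_simps flip: scaleR_matrix_vector_assoc)
qed

lemma fluct_field_has_derivative:
  fixes A :: "real ^ 'd ^ 'd"
  assumes "continuous (at 0 within {0..}) f"
  shows "(fluct_field \<gamma> \<beta> k \<alpha> f A has_derivative
      collapsed_linearization \<gamma> (k * real CARD('j) * f 0 - \<alpha>))
    (at (0 :: ('d::finite, 'j::finite) state) within zero_mean_states)"
proof -
  let ?F = "at (0 :: ('d, 'j) state) within zero_mean_states"
  have fst_comp: "bounded_linear (\<lambda>s :: ('d, 'j) state. fst s $ j)" for j
    by (rule bounded_linear_compose[OF bounded_linear_vec_nth bounded_linear_fst])
  have snd_comp: "bounded_linear (\<lambda>s :: ('d, 'j) state. snd s $ j)" for j
    by (rule bounded_linear_compose[OF bounded_linear_vec_nth bounded_linear_snd])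
  have lim_fst: "((\<lambda>s. fst s $ j) \<longlongrightarrow> 0) ?F" for j
    using bounded_linear.tendsto[OF fst_comp tendsto_ident_at, of j 0 zero_mean_states]
    by simp
  have lim_A: "((\<lambda>s. A *v (fst s $ j)) \<longlongrightarrow> 0) ?F" for j
    using bounded_linear.tendsto[OF matrix_vector_mul_bounded_linear lim_fst, of A j] by simp
  have cov: "((\<lambda>s. (fst s $ i \<bullet> (A *v (fst s $ j))) *\<^sub>R (fst s $ i)) has_derivative (\<lambda>_. 0)) ?F"
    for i j
    using tendsto_inner[OF lim_fst lim_A, of i j]
    by (intro has_derivative_scaleR_infinitesimal fst_comp) simp
  \<comment> \<open>Distances stay in the half line, so one-sided continuity of \<open>f\<close>
    suffices; particles that coincide give the value \<open>f 0\<close> itself.\<close>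
  have "((\<lambda>s. f (norm (fst s $ i - fst s $ j)) - f 0) \<longlongrightarrow> 0) ?F" for i j
    using tendsto_norm_zero[OF tendsto_diff[OF lim_fst lim_fst, of i j, simplified]]
    by (intro LIM_zero continuous_within_tendsto_compose[OF assms]) auto
  then have rep: "((\<lambda>s. (f (norm (fst s $ i - fst s $ j)) - f 0) *\<^sub>R (fst s $ j - fst s $ i))
      has_derivative (\<lambda>_. 0)) ?F" for i j
    by (intro has_derivative_scaleR_infinitesimal bounded_linear_sub fst_comp)
  let ?c = "k * real CARD('j) * f 0 - \<alpha>"
  have comp: "((\<lambda>s. (- \<gamma> *\<^sub>R (snd s $ j) + ?c *\<^sub>R (fst s $ j))
      - (\<beta> / real CARD('j)) *\<^sub>R (\<Sum>i\<in>UNIV. (fst s $ i \<bullet> (A *v (fst s $ j))) *\<^sub>R (fst s $ i))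
      + k *\<^sub>R (\<Sum>i\<in>UNIV - {j}.
          (f (norm (fst s $ i - fst s $ j)) - f 0) *\<^sub>R (fst s $ j - fst s $ i)))
    has_derivative (\<lambda>s. - \<gamma> *\<^sub>R (snd s $ j) + ?c *\<^sub>R (fst s $ j))) ?F" for j
  proof -
    have lin: "((\<lambda>s. - \<gamma> *\<^sub>R (snd s $ j) + ?c *\<^sub>R (fst s $ j)) has_derivative
        (\<lambda>s. - \<gamma> *\<^sub>R (snd s $ j) + ?c *\<^sub>R (fst s $ j))) ?F"
      by (intro has_derivative_add has_derivative_scaleR_right
          bounded_linear_imp_has_derivative[OF fst_comp] bounded_linear_imp_has_derivative[OF snd_comp])
    show ?thesis
      using has_derivative_add[OF has_derivative_diff[OF lin
          has_derivative_scaleR_right[OF has_derivative_sum[OF cov, where I = UNIV], of "\<beta> / real CARD('j)"]]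
          has_derivative_scaleR_right[OF has_derivative_sum[OF rep, where I = "UNIV - {j}"], of k]]
      by simp
  qed
  have "((\<lambda>s. (snd s, \<chi> j. (- \<gamma> *\<^sub>R (snd s $ j) + ?c *\<^sub>R (fst s $ j))
      - (\<beta> / real CARD('j)) *\<^sub>R (\<Sum>i\<in>UNIV. (fst s $ i \<bullet> (A *v (fst s $ j))) *\<^sub>R (fst s $ i))
      + k *\<^sub>R (\<Sum>i\<in>UNIV - {j}.
          (f (norm (fst s $ i - fst s $ j)) - f 0) *\<^sub>R (fst s $ j - fst s $ i))))
    has_derivative collapsed_linearization \<gamma> ?c) ?F"
    unfolding collapsed_linearization_def
    by (intro has_derivative_Pair has_derivative_vec_lambda has_derivative_snd
        has_derivative_ident comp)
  \<comment> \<open>The decomposition agrees with the field on \<open>zero_mean_states\<close>, a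
    set containing the base point 0, which is enough for a derivative within that set.\<close>
  then show ?thesis
    by (rule has_derivative_transform[rotated 2]) 
      (simp add: zero_mean_states_def, rule fluct_field_zero_mean)
qed

section \<open>An unstable eigenvalue of the linearization\<close>

lemma exists_zero_mean_nonzero:
  assumes "CARD('j::finite) \<ge> 2"
  obtains X :: "real ^ 'd ^ 'j" where "X \<noteq> 0" "(\<Sum>j\<in>UNIV. X $ j) = 0"
proof -
  obtain a b :: 'j where "a \<noteq> b"
    using assms by (auto simp: numeral_2_eq_2 card_le_Suc_iff)
  \<comment> \<open>The inner \<open>1\<close> is the all-ones vector, so particles \<open>a\<close>
    and \<open>b\<close> are displaced oppositely.\<close>
  let ?X = "axis a 1 - axis b 1 :: real ^ 'd ^ 'j"
  have "(\<Sum>j\<in>UNIV. ?X $ j) = 0"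
    by (simp add: sum_subtractf axis_def)
  moreover have "?X $ a \<noteq> 0"
    using \<open>a \<noteq> b\<close> by (simp add: axis_eq_0_iff axis_def)
  then have "?X \<noteq> 0" by (metis zero_index)
  ultimately show thesis using that by blast
qed

text \<open>The ansatz of velocity \<open>l\<close> times position reduces the eigenvalue equation
  to \<open>c - \<gamma> * l = l * l\<close>, whatever the zero-mean profile
  \<open>X\<close>.\<close>

lemma collapsed_linearization_eigenvalue:
  assumes "CARD('j::finite) \<ge> 2" and "l ^ 2 + \<gamma> * l = c"
  shows "complex_eigenvalue_on zero_mean_states
    (collapsed_linearization \<gamma> c :: ('d::finite, 'j) state \<Rightarrow> _) (of_real l)"
proof -
  obtain X :: "real ^ 'd ^ 'j" where X: "X \<noteq> 0" "(\<Sum>j\<in>UNIV. X $ j) = 0"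
    using exists_zero_mean_nonzero[OF assms(1)] .
  have "c - \<gamma> * l = l * l" using assms(2) by (simp add: power2_eq_square)
  then have "c *\<^sub>R v - (\<gamma> * l) *\<^sub>R v = (l * l) *\<^sub>R v" for v :: "real ^ 'd"
    by (simp flip: scaleR_diff_left)
  then have eig: "collapsed_linearization \<gamma> c (X, l *\<^sub>R X) = l *\<^sub>R (X, l *\<^sub>R X)"
    by (simp add: collapsed_linearization_def vec_eq_iff)
  have "(X, l *\<^sub>R X) \<in> zero_mean_states"
    using X(2) by (simp add: zero_mean_states_def flip: scaleR_sum_right)
  moreover have "0 \<in> zero_mean_states" "collapsed_linearization \<gamma> c 0 = 0"
    by (simp_all add: zero_mean_states_def collapsed_linearization_def vec_eq_iff zero_prod_def)
  ultimately show ?thesis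
    unfolding complex_eigenvalue_on_def
    using X(1) eig
    \<comment> \<open>The eigenvalue is real, so the imaginary part of the eigenvector can be
      0.\<close>
    by (intro bexI[of _ "(X, l *\<^sub>R X)"] bexI[of _ 0]) (simp_all add: zero_prod_def)
qed

lemma positive_characteristic_root:
  fixes \<gamma> c :: real
  assumes "c > 0"
  obtains l where "l > 0" "l ^ 2 + \<gamma> * l = c"
proof
  \<comment> \<open>Root of the discriminant; \<open>c > 0\<close> makes it exceed
    \<open>\<bar>\<gamma>\<bar>\<close>, so the larger root is positive.\<close>
  let ?r = "sqrt (\<gamma>\<^sup>2 + 4 * c)"
  have "\<bar>\<gamma>\<bar> < ?r" using assms by (intro real_less_rsqrt) simp
  then show "(?r - \<gamma>) / 2 > 0" by simp
  have "?r\<^sup>2 = \<gamma>\<^sup>2 + 4 * c" using assms by simp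
  then show "((?r - \<gamma>) / 2) ^ 2 + \<gamma> * ((?r - \<gamma>) / 2) = c"
    by (simp add: power2_eq_square field_simps)
qed

lemma collapsed_state_zero_mean_linearly_unstable:
  fixes A :: "real ^ 'd ^ 'd"
  assumes "CARD('j::finite) \<ge> 2" "continuous (at 0 within {0..}) f"
    and "k * real CARD('j) * f 0 > \<alpha>"
  shows "zero_mean_linearly_unstable (eki_field \<gamma> \<beta> k \<alpha> f A b) (fluct_field \<gamma> \<beta> k \<alpha> f A)
    (collapsed_state x :: ('d, 'j) state)"
proof -
  \<comment> \<open>Supercriticality enters here, as positivity of the right-hand side.\<close>
  obtain l where "l > 0" "l ^ 2 + \<gamma> * l = k * real CARD('j) * f 0 - \<alpha>"
    using positive_characteristic_root assms(3) by (metis diff_gt_0_iff_gt)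
  with collapsed_linearization_eigenvalue[OF assms(1)] fluct_field_has_derivative[OF assms(2)]
  show ?thesis
    unfolding zero_mean_linearly_unstable_def unstable_linearization_on_def
      fluctuation_collapsed_state
    by (metis fluctuation_eki_field Re_complex_of_real)
qed

section \<open>Interaction kernels and the power-law threshold\<close>

lemma interaction_kernel_continuous:
  assumes "interaction_kernel f" "r \<ge> 0"
  shows "continuous (at r within {0..}) f"
  using assms unfolding interaction_kernel_def smooth_on_half_line_def
  by (metis DERIV_continuous)

lemma power_kernel_interaction_kernel:
  assumes "\<epsilon> > 0" "p > 0"
  shows "interaction_kernel (power_kernel \<epsilon> p)"
  unfolding interaction_kernel_def
proof (intro conjI allI impI)
  \<comment> \<open>The n-th derivative: each differentiation brings down the current exponent, and
    the empty product at \<open>n = 0\<close> leaves the kernel. The base is at least \<epsilon>,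
    hence positive, even at \<open>r = 0\<close>.\<close>
  let ?F = "\<lambda>n r. (\<Prod>i<n. - p - real i) * (\<epsilon> + r) powr (- p - real n)"
  have "(?F n has_real_derivative ?F (Suc n) r) (at r within {0..})" if "r \<ge> 0" for n r
    using that assms by (auto intro!: derivative_eq_intros simp: algebra_simps)
  then show "smooth_on_half_line (power_kernel \<epsilon> p)"
    unfolding smooth_on_half_line_def
    by (intro exI[of _ ?F]) (auto simp: power_kernel_def fun_eq_iff)
  show "antimono_on {0..} (power_kernel \<epsilon> p)"
    using assms by (auto simp: monotone_on_def power_kernel_def intro!: powr_mono2')
  show "0 < power_kernel \<epsilon> p r" if "r \<ge> 0" for r
    using that assms by (simp add: power_kernel_def)
qed

text \<open>The kernel at 0 is \<open>\<epsilon> powr (- p)\<close>; multiply by the positive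
  \<open>\<epsilon> powr p / J\<close>.\<close>

lemma power_kernel_supercritical_iff:
  assumes "\<epsilon> > 0" "J > 0"
  shows "k * J * power_kernel \<epsilon> p 0 > \<alpha> \<longleftrightarrow> k > \<alpha> * \<epsilon> powr p / J"
  using assms by (simp add: power_kernel_def powr_minus field_simps)

theorem proposition3p4:
  fixes G :: "real ^ 'd ^ 'm" and \<Gamma> :: "real ^ 'm ^ 'm" and y :: "real ^ 'm"
    and A :: "real ^ 'd ^ 'd" and b :: "real ^ 'd"
    and \<gamma> \<beta> k \<alpha> :: real
    and xstar :: "real ^ 'd" and s :: "('d, 'j::finite) state"
  assumes "CARD('j) \<ge> 2"
    and "sym_pos_def \<Gamma>"
    and "A = eki_A G \<Gamma>" and "b = eki_b G \<Gamma> y"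
    and "\<gamma> > 0" and "\<beta> > 0" and "k \<ge> 0" and "\<alpha> \<ge> 0"
    and "s = collapsed_state xstar"
  shows "(\<forall>f. interaction_kernel f \<and> continuous (at 0 within {0..}) f \<and> f 0 > 0 \<and>
              k * real CARD('j) * f 0 > \<alpha> \<longrightarrow>
            zero_mean_linearly_unstable
              (eki_field \<gamma> \<beta> k \<alpha> f A b) (fluct_field \<gamma> \<beta> k \<alpha> f A) s) \<and>
         (\<forall>\<epsilon> p. \<epsilon> > 0 \<and> p > 1 \<longrightarrow>
            interaction_kernel (power_kernel \<epsilon> p) \<and>
            (k * real CARD('j) * power_kernel \<epsilon> p 0 > \<alpha> \<longleftrightarrow>
               k > \<alpha> * \<epsilon> powr p / real CARD('j)) \<and>
            (k > \<alpha> * \<epsilon> powr p / real CARD('j) \<longrightarrow>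
               zero_mean_linearly_unstable
                 (eki_field \<gamma> \<beta> k \<alpha> (power_kernel \<epsilon> p) A b)
                 (fluct_field \<gamma> \<beta> k \<alpha> (power_kernel \<epsilon> p) A) s))"
proof -
  \<comment> \<open>Serves both halves: \<open>kernel\<close> admits the power law as an instance
    and \<open>critical\<close> translates its threshold.\<close>
  have unstable: "zero_mean_linearly_unstable (eki_field \<gamma> \<beta> k \<alpha> f A b) (fluct_field \<gamma> \<beta> k \<alpha> f A) s"
    if "interaction_kernel f" "k * real CARD('j) * f 0 > \<alpha>" for f
    unfolding \<open>s = collapsed_state xstar\<close>
    using assms(1) interaction_kernel_continuous[OF that(1)] that(2)
    by (intro collapsed_state_zero_mean_linearly_unstable) auto
  have kernel: "interaction_kernel (power_kernel \<epsilon> p)" if "\<epsilon> > 0" "p > 1" for \<epsilon> p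
    using that by (intro power_kernel_interaction_kernel) auto
  have critical: "k * real CARD('j) * power_kernel \<epsilon> p 0 > \<alpha> \<longleftrightarrow> k > \<alpha> * \<epsilon> powr p / real CARD('j)"
    if "\<epsilon> > 0" for \<epsilon> p
    using that by (intro power_kernel_supercritical_iff) auto
  show ?thesis
    using unstable kernel critical by blast
qed

end
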